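(* Let $f:\mathbb{R}^n\to\mathbb{R}\cup\{+\infty\}$ be a proper, lower semicontinuous function that is scale invariant and signed permutation invariant, and let $\rho>0$. Let $x\in\mathbb{R}^n_{\downarrow}$ and define $F(u):=\frac{\rho}{2}\|u-x\|_2^2+f(u)$ for $u\in\mathbb{R}^n$. Then $x^\star\in\mathrm{prox}_{\frac1\rho f}(x)$ if and only if $x^\star$ is given by $$x^\star\in\begin{cases}\{0\}, & \text{if } F(0)<F(\langle x,w^\star\rangle w^\star);\\ \{0,\langle x,w^\star\rangle w^\star\}, & \text{if } F(0)=F(\langle x,w^\star\rangle w^\star);\\ \{\langle x,w^\star\rangle w^\star\}, & \text{otherwise,}\end{cases}$$ where $w^\star$ is a solution to the optimization problem $$\min\left\{-\frac{\rho}{2}\langle x,w\rangle^2+f(w): w\in\mathbb{S}^{n-1}_+\right\}.$$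
   Context: $\mathbb{R}^n_\downarrow=\{x\in\mathbb{R}^n: x_1\ge x_2\ge\dots\ge x_n\ge 0\}$. $\mathbb{S}^{n-1}_+$ is the set of vectors of Euclidean norm $1$ in $\mathbb{R}^n$ with all entries nonnegative. A function $f$ is scale invariant if $f(\alpha x)=f(x)$ for all $x\in\mathbb{R}^n$ and $\alpha>0$. It is signed permutation invariant if $f(Px)=f(x)$ for all $x\in\mathbb{R}^n$ and all $n\times n$ signed permutation matrices $P$ (exactly one nonzero entry, equal to $\pm1$, in every row and column). For $\alpha>0$, $\mathrm{prox}_{\alpha f}(z):=\arg\min\{\frac{1}{2\alpha}\|x-z\|_2^2+f(x):x\in\mathbb{R}^n\}$ is the set of all minimizers; for scale and signed permutation invariant $f$ it is always assumed that this set is nonempty and compact for every $z$.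
   Formalization: The printed "only if" fails when x has zero entries, since prox may contain sign-flipped minimizers; here x* lies in the case set for some solution w* up to sign flips at coordinates with x_i = 0, which is the literal equivalence when all x_i > 0. *)

theory Defs
  imports "HOL-Analysis.Analysis"
begin

text \<open>
  Functions with values in \<open>\<real> \<union> {+\<infinity>}\<close> are rendered as \<^typ>\<open>ereal\<close>-valued functions; the value
  \<open>-\<infinity>\<close> is excluded by properness.
\<close>

definition proper_fun :: "('a \<Rightarrow> ereal) \<Rightarrow> bool" where
  "proper_fun f \<longleftrightarrow> (\<forall>u. f u \<noteq> -\<infinity>) \<and> (\<exists>u. f u \<noteq> \<infinity>)"

definition lower_semicontinuous :: "('a::topological_space \<Rightarrow> ereal) \<Rightarrow> bool" where
  "lower_semicontinuous f \<longleftrightarrow> (\<forall>u. f u \<le> Liminf (at u) f)"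

definition scale_invariant :: "('a::real_vector \<Rightarrow> ereal) \<Rightarrow> bool" where
  "scale_invariant f \<longleftrightarrow> (\<forall>\<alpha>>0. \<forall>u. f (\<alpha> *\<^sub>R u) = f u)"

definition signed_permutation_matrix :: "real ^ 'n ^ 'n \<Rightarrow> bool" where
  "signed_permutation_matrix P \<longleftrightarrow>
     (\<forall>i. \<exists>!j. P $ i $ j \<noteq> 0) \<and> (\<forall>j. \<exists>!i. P $ i $ j \<noteq> 0) \<and>
     (\<forall>i j. P $ i $ j \<noteq> 0 \<longrightarrow> P $ i $ j = 1 \<or> P $ i $ j = -1)"

definition signed_permutation_invariant :: "(real ^ 'n \<Rightarrow> ereal) \<Rightarrow> bool" where
  "signed_permutation_invariant f \<longleftrightarrow>
     (\<forall>P u. signed_permutation_matrix P \<longrightarrow> f (P *v u) = f u)"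

definition prox :: "real \<Rightarrow> ('a::real_normed_vector \<Rightarrow> ereal) \<Rightarrow> 'a \<Rightarrow> 'a set" where
  "prox \<alpha> f z =
     {u. is_arg_min (\<lambda>u. ereal (1 / (2 * \<alpha>) * (norm (u - z))\<^sup>2) + f u) (\<lambda>_. True) u}"

text \<open>
  The order \<open>1 < \<dots> < n\<close> of the coordinates is the linear order of the finite index type.
\<close>

definition nonneg_decreasing :: "(real ^ 'n::{finite, linorder}) set" where
  "nonneg_decreasing = {u. (\<forall>i j. i \<le> j \<longrightarrow> u $ j \<le> u $ i) \<and> (\<forall>i. 0 \<le> u $ i)}"

definition nonneg_sphere :: "(real ^ 'n) set" where
  "nonneg_sphere = {w \<in> sphere 0 1. \<forall>i. 0 \<le> w $ i}"

text \<open>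
  Pitfall: if \<open>x $ i = 0\<close>, flipping the sign of coordinate \<open>i\<close> maps \<open>prox \<alpha> f x\<close> to itself, so the
  minimizers described through \<^const>\<open>nonneg_sphere\<close> exhaust \<open>prox \<alpha> f x\<close> only up to sign flips
  at the zero coordinates of \<open>x\<close>.
\<close>

end

theory Submission
  imports Defs
begin

text \<open>
  On a ray through a unit vector \<open>w\<close>, scale invariance makes \<open>f\<close> constant away from \<open>0\<close>, so
  completing the square in \<open>F (t w)\<close> shows that the only candidates for minimizers are \<open>0\<close> and
  \<open>\<langle>x, w\<rangle> w\<close>, the latter with value \<open>\<rho>/2 \<parallel>x\<parallel>\<^sup>2 - \<rho>/2 \<langle>x, w\<rangle>\<^sup>2 + f w\<close>; minimizing over \<open>w\<close> is then the
  spherical problem. Lower semicontinuity and scale invariance make \<open>0\<close> a global minimizer of \<open>f\<close>,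
  which excludes directions with \<open>\<langle>x, w\<rangle> \<le> 0\<close>. Flipping a negative coordinate of a minimizer
  strictly decreases the quadratic term unless the same coordinate of \<open>x\<close> vanishes, so up to such
  flips the minimizer lies in the nonnegative orthant.
\<close>

section \<open>Semicontinuity, compactness and existence of minimizers\<close>

lemma open_superlevel_lsc:
  assumes "lower_semicontinuous f"
  shows "open {u. c < f u}"
proof -
  have "eventually (\<lambda>v. c < f v) (nhds u)" if "c < f u" for u
  proof -
    have "f u \<le> Liminf (at u) f"
      using assms by (simp add: lower_semicontinuous_def)
    then have "eventually (\<lambda>v. c < f v) (at u)"
      using that le_Liminf_iff by blast
    \<comment> \<open>The limit inferior along \<open>at u\<close> ignores the point
      \<open>u\<close> itself; \<open>c < f u\<close> fills that gap.\<close>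
    then show ?thesis
      using that unfolding eventually_at_filter by (auto elim!: eventually_mono)
  qed
  then show ?thesis
    by (subst open_subopen) (fastforce simp: eventually_nhds)
qed

text \<open>A real threshold \<open>r\<close> inserted below \<open>f u\<close> separates the
  summands, so the set is a union over \<open>r\<close> of intersections of two open sets. Density
  of the reals gives \<open>r\<close> even when \<open>c\<close> or \<open>f u\<close> is
  infinite.\<close>

lemma open_superlevel_continuous_add_lsc:
  fixes h :: "'a::topological_space \<Rightarrow> real"
  assumes "continuous_on UNIV h" and "lower_semicontinuous f"
  shows "open {u. c < ereal (h u) + f u}"
proof -
  have eq: "c < ereal (h u) + f u \<longleftrightarrow> (\<exists>r. c < ereal (h u + r) \<and> ereal r < f u)" for u
  proof
    assume "c < ereal (h u) + f u"
    then have "c - ereal (h u) < f u"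
      by (cases c; cases "f u") auto
    then obtain r where "c - ereal (h u) < ereal r" "ereal r < f u"
      using ereal_dense2 by blast
    then show "\<exists>r. c < ereal (h u + r) \<and> ereal r < f u"
      by (intro exI[of _ r]) (cases c, auto)
  next
    assume "\<exists>r. c < ereal (h u + r) \<and> ereal r < f u"
    then obtain r where r: "c < ereal (h u + r)" "ereal r < f u"
      by blast
    then show "c < ereal (h u) + f u"
      by (cases "f u"; cases c) auto
  qed
  have "{u. c < ereal (h u) + f u} = (\<Union>r. {u. c < ereal (h u + r)} \<inter> {u. ereal r < f u})"
    by (auto simp: eq)
  also have "open \<dots>"
    by (intro open_UN ballI open_Int open_superlevel_lsc open_Collect_less continuous_intros assms)
  finally show ?thesis .
qed

text \<open>Without a minimizer, the open sets \<open>{u. g v < g u}\<close> with \<open>v\<close>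
  in \<open>K\<close> cover \<open>K\<close>. In a finite subcover, the index with the least value
  of \<open>g\<close> is itself left uncovered.\<close>

lemma compact_ex_arg_min:
  fixes g :: "'a::topological_space \<Rightarrow> 'b::linorder"
  assumes "compact K" "K \<noteq> {}" and op: "\<And>c. open {u. c < g u}"
  shows "\<exists>w. is_arg_min g (\<lambda>w. w \<in> K) w"
proof (rule ccontr)
  assume no_min: "\<nexists>w. is_arg_min g (\<lambda>w. w \<in> K) w"
  then have step: "\<exists>v\<in>K. g v < g w" if "w \<in> K" for w
    using that by (auto simp: is_arg_min_def)
  have "K \<subseteq> (\<Union>v\<in>K. {u. g v < g u})"
    using step by auto
  then obtain D where D: "D \<subseteq> K" "finite D" "K \<subseteq> (\<Union>v\<in>D. {u. g v < g u})"
    using compactE_image[OF assms(1), of K "\<lambda>v. {u. g v < g u}"] op by metis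
  then have "D \<noteq> {}"
    using assms(2) by auto
  then obtain d where d: "d \<in> D" "\<And>v. v \<in> D \<Longrightarrow> g d \<le> g v"
    using ex_min_if_finite[of "g ` D"] D(2) by (force simp: not_less)
  then show False
    using D by fastforce
qed

text \<open>The points \<open>t *\<^sub>R u\<close> with \<open>t > 0\<close> tend to 0 while
  \<open>f\<close> keeps the value \<open>f u\<close> on them; semicontinuity at 0 rules out
  \<open>f u < f 0\<close>.\<close>

lemma scale_invariant_lsc_zero_le:
  fixes f :: "'a::real_normed_vector \<Rightarrow> ereal"
  assumes "lower_semicontinuous f" "scale_invariant f"
  shows "f 0 \<le> f u"
proof (rule ccontr)
  assume "\<not> f 0 \<le> f u"
  then have "f u < f 0"
    by simp
  then have "eventually (\<lambda>v. f u < f v) (nhds 0)"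
    using open_superlevel_lsc[OF assms(1), of "f u"] by (auto simp: eventually_nhds)
  moreover have "((\<lambda>t. t *\<^sub>R u) \<longlongrightarrow> 0) (at_right (0::real))"
    by (auto intro!: tendsto_eq_intros)
  ultimately have "eventually (\<lambda>t. f u < f (t *\<^sub>R u)) (at_right (0::real))"
    by (rule eventually_compose_filterlim)
  moreover have "eventually (\<lambda>t::real. t > 0) (at_right 0)"
    by (simp add: eventually_at_right_less)
  ultimately have "eventually (\<lambda>t::real. False) (at_right 0)"
    by eventually_elim (use assms(2) in \<open>simp add: scale_invariant_def\<close>)
  then show False
    by (simp add: trivial_limit_at_right_real)
qed

section \<open>The objective along a ray\<close>

lemma norm_scaleR_unit_diff_sq:
  fixes w x :: "'a::real_inner"
  assumes "norm w = 1"
  shows "(norm (t *\<^sub>R w - x))\<^sup>2 = (norm x)\<^sup>2 - (x \<bullet> w)\<^sup>2 + (t - x \<bullet> w)\<^sup>2"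
proof -
  have "w \<bullet> w = 1"
    using assms by (simp add: dot_square_norm)
  then show ?thesis
    unfolding power2_norm_eq_inner
    by (simp add: inner_diff inner_commute power2_eq_square algebra_simps)
qed

text \<open>Equality can fail only for \<open>x \<bullet> w = 0\<close>: the projection is then 0,
  and \<open>f 0\<close> may lie strictly below \<open>f w\<close>.\<close>

lemma prox_objective_at_projection_le:
  fixes f :: "'a::real_inner \<Rightarrow> ereal"
  assumes "scale_invariant f" "f 0 \<le> f w" "norm w = 1" "0 \<le> x \<bullet> w"
  shows "ereal (\<rho> / 2 * (norm ((x \<bullet> w) *\<^sub>R w - x))\<^sup>2) + f ((x \<bullet> w) *\<^sub>R w)
    \<le> ereal (\<rho> / 2 * (norm x)\<^sup>2) + (ereal (- (\<rho> / 2) * (x \<bullet> w)\<^sup>2) + f w)"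
proof -
  have "f ((x \<bullet> w) *\<^sub>R w) \<le> f w"
    using assms by (cases "x \<bullet> w = 0") (auto simp: scale_invariant_def)
  then show ?thesis
    unfolding norm_scaleR_unit_diff_sq[OF assms(3)]
    by (cases "f w"; cases "f ((x \<bullet> w) *\<^sub>R w)") (auto simp: algebra_simps)
qed

text \<open>On the ray through \<open>u\<close> the objective is a parabola in \<open>t\<close> with
  vertex \<open>x \<bullet> w\<close>. Comparison with 0 makes the vertex positive; comparison with
  the vertex then determines \<open>norm u\<close>.\<close>

lemma nonzero_prox_objective_minimizer:
  fixes f :: "'a::real_inner \<Rightarrow> ereal"
  assumes "scale_invariant f" "f 0 \<le> f u" "\<bar>f 0\<bar> \<noteq> \<infinity>" "\<rho> > 0" "u \<noteq> 0"
    and F: "\<And>v. F v = ereal (\<rho> / 2 * (norm (v - x))\<^sup>2) + f v"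
    and min: "\<And>v. F u \<le> F v"
  defines "w \<equiv> u /\<^sub>R norm u"
  shows "u = (x \<bullet> w) *\<^sub>R w"
    and "F u = ereal (\<rho> / 2 * (norm x)\<^sup>2) + (ereal (- (\<rho> / 2) * (x \<bullet> w)\<^sup>2) + f w)"
proof -
  define a where "a = x \<bullet> w"
  have nw: "norm w = 1" and u: "u = norm u *\<^sub>R w" and n: "norm u > 0"
    using assms(5) by (simp_all add: w_def)
  have fray: "f (t *\<^sub>R w) = f u" if "t > 0" for t
    using that n assms(1) unfolding scale_invariant_def w_def by simp
  have "F 0 \<noteq> \<infinity>"
    using assms(3) by (auto simp: F)
  then have "F u \<noteq> \<infinity>"
    using min[of 0] by auto
  then obtain r where r: "f u = ereal r"
    using assms(2,3) by (cases "f u"; cases "f 0") (auto simp: F)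
  obtain r0 where r0: "f 0 = ereal r0" "r0 \<le> r"
    using assms(2,3) r by (cases "f 0") auto
  have Fray: "F (t *\<^sub>R w) = ereal (\<rho> / 2 * ((norm x)\<^sup>2 - a\<^sup>2 + (t - a)\<^sup>2) + r)" if "t > 0" for t
    using that by (simp add: F norm_scaleR_unit_diff_sq[OF nw] fray r a_def)
  have Fu: "F u = ereal (\<rho> / 2 * ((norm x)\<^sup>2 - a\<^sup>2 + (norm u - a)\<^sup>2) + r)"
    using Fray[OF n] u by simp
  \<comment> \<open>Replacing \<open>f 0\<close> by the larger value \<open>r\<close> leaves a
    comparison of quadratic terms alone, which yields \<open>norm u \<le> 2 * a\<close>.\<close>
  have "F u \<le> ereal (\<rho> / 2 * (norm x)\<^sup>2 + r)"
    using min[of 0] r0 by (simp add: F) (meson add_left_mono ereal_less_eq(3) order_trans)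
  then have "\<rho> / 2 * ((norm u - a)\<^sup>2 - a\<^sup>2) \<le> 0"
    unfolding Fu by (simp add: algebra_simps)
  then have "(norm u - a)\<^sup>2 - a\<^sup>2 \<le> 0"
    using assms(4) by (simp add: mult_le_0_iff)
  then have "norm u * (norm u - 2 * a) \<le> 0"
    by (simp add: power2_eq_square algebra_simps)
  then have "norm u \<le> 2 * a"
    using n by (simp add: mult_le_0_iff)
  \<comment> \<open>Only for positive \<open>a\<close> is \<open>f (a *\<^sub>R w)\<close> known to
    equal \<open>f u\<close>, so only now can the vertex serve as a competitor.\<close>
  then have "a > 0"
    using n by linarith
  then have "\<rho> / 2 * (norm u - a)\<^sup>2 \<le> 0"
    using min[of "a *\<^sub>R w"] Fray[of a] unfolding Fu by (simp add: algebra_simps)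
  then have "norm u = a"
    using assms(4) by (simp add: mult_le_0_iff)
  then show "u = (x \<bullet> w) *\<^sub>R w"
    using u a_def by simp
  have "f w = ereal r"
    using fray[of 1] r by simp
  then show "F u = ereal (\<rho> / 2 * (norm x)\<^sup>2) + (ereal (- (\<rho> / 2) * (x \<bullet> w)\<^sup>2) + f w)"
    using \<open>norm u = a\<close> by (simp add: Fu a_def algebra_simps)
qed

section \<open>Sign flips of coordinates\<close>

lemma signed_permutation_invariant_signs:
  fixes f :: "real ^ 'n \<Rightarrow> ereal" and s u :: "real ^ 'n"
  assumes "signed_permutation_invariant f" and s: "\<And>i. s $ i = 1 \<or> s $ i = -1"
  shows "f (\<chi> i. s $ i * u $ i) = f u"
proof -
  define P :: "real ^ 'n ^ 'n" where "P = (\<chi> i j. if i = j then s $ i else 0)"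
  have nz: "s $ i \<noteq> 0" for i
    using s[of i] by auto
  then have "signed_permutation_matrix P"
    using s by (auto simp: signed_permutation_matrix_def P_def)
  moreover have "P *v u = (\<chi> i. s $ i * u $ i)"
    by (simp add: P_def matrix_vector_mult_def vec_eq_iff if_distrib[of "\<lambda>a. a * _"] sum.delta
        cong: if_cong)
  ultimately show ?thesis
    using assms(1) by (metis signed_permutation_invariant_def)
qed

lemma norm_signs:
  fixes s u :: "real ^ 'n"
  assumes "\<And>i. s $ i = 1 \<or> s $ i = -1"
  shows "norm (\<chi> i. s $ i * u $ i) = norm u"
proof -
  have "\<bar>s $ i\<bar> = 1" for i
    using assms[of i] by auto
  then show ?thesis
    by (simp add: norm_vec_def abs_mult)
qed

text \<open>Such a flip fixes \<open>x\<close>, so it acts on \<open>u - x\<close> as an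
  isometry.\<close>

lemma dist_signs:
  fixes s u x :: "real ^ 'n"
  assumes "\<And>i. s $ i = 1 \<or> (s $ i = -1 \<and> x $ i = 0)"
  shows "norm ((\<chi> i. s $ i * u $ i) - x) = norm (u - x)"
proof -
  have "(\<chi> i. s $ i * u $ i) - x = (\<chi> i. s $ i * (u - x) $ i)"
  proof (rule vec_eq_iff[THEN iffD2], rule allI)
    fix i
    show "((\<chi> i. s $ i * u $ i) - x) $ i = (\<chi> i. s $ i * (u - x) $ i) $ i"
      using assms[of i] by auto
  qed
  then show ?thesis
    using norm_signs[of s "u - x"] assms by metis
qed

text \<open>Flipping coordinate \<open>i\<close> preserves \<open>f\<close> and the norm, so
  minimality compares only the inner products with \<open>x\<close>; these differ by
  \<open>2 * u $ i * x $ i\<close>. Finiteness of \<open>f u\<close> allows its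
  cancellation.\<close>

lemma minimizer_neg_coordinate:
  fixes f F :: "real ^ 'n \<Rightarrow> ereal" and u x :: "real ^ 'n"
  assumes "signed_permutation_invariant f" "\<bar>f u\<bar> \<noteq> \<infinity>" "\<rho> > 0"
    and F: "\<And>v. F v = ereal (\<rho> / 2 * (norm (v - x))\<^sup>2) + f v"
    and min: "\<And>v. F u \<le> F v"
    and "u $ i < 0" "0 \<le> x $ i"
  shows "x $ i = 0"
proof -
  define s :: "real ^ 'n" where "s = (\<chi> j. if j = i then -1 else 1)"
  define v where "v = (\<chi> j. s $ j * u $ j)"
  have v: "v = u - axis i (2 * u $ i)"
    by (auto simp: v_def s_def axis_def vec_eq_iff)
  have s: "s $ j = 1 \<or> s $ j = -1" for j
    by (simp add: s_def)
  have "f v = f u" "norm v = norm u"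
    unfolding v_def by (rule signed_permutation_invariant_signs[OF assms(1) s], rule norm_signs[OF s])
  then have "\<rho> / 2 * (norm (u - x))\<^sup>2 \<le> \<rho> / 2 * (norm (v - x))\<^sup>2"
    using min[of v] assms(2) by (cases "f u") (auto simp: F)
  then have "(norm (u - x))\<^sup>2 \<le> (norm (v - x))\<^sup>2"
    using assms(3) by simp
  moreover have "(norm (y - x))\<^sup>2 = (norm y)\<^sup>2 - 2 * (y \<bullet> x) + (norm x)\<^sup>2" for y
    by (simp add: power2_norm_eq_inner inner_diff inner_commute)
  ultimately have "v \<bullet> x \<le> u \<bullet> x"
    using \<open>norm v = norm u\<close> by simp
  then have "u $ i * x $ i \<ge> 0"
    by (simp add: v inner_diff_left inner_axis')
  then show ?thesis
    using assms(6,7) by (simp add: zero_le_mult_iff)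
qed

section \<open>The nonnegative part of the unit sphere\<close>

lemma compact_nonneg_sphere: "compact (nonneg_sphere :: (real ^ 'n) set)"
proof -
  have "closed (\<Inter>i. {w :: real ^ 'n. 0 \<le> w $ i})"
    by (intro closed_INT ballI closed_Collect_le continuous_intros)
  moreover have "nonneg_sphere = sphere 0 1 \<inter> (\<Inter>i. {w :: real ^ 'n. 0 \<le> w $ i})"
    by (auto simp: nonneg_sphere_def)
  ultimately show ?thesis
    using compact_Int_closed[OF compact_sphere] by metis
qed

lemma nonneg_sphere_nonempty: "(nonneg_sphere :: (real ^ 'n) set) \<noteq> {}"
proof -
  have "axis undefined 1 \<in> (nonneg_sphere :: (real ^ 'n) set)"
    by (simp add: nonneg_sphere_def axis_def norm_axis_1[unfolded axis_def])
  then show ?thesis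
    by blast
qed

section \<open>Minimizers of the objective and the spherical problem\<close>

theorem theorem2p3:
  fixes f F :: "real ^ 'n::{finite, linorder} \<Rightarrow> ereal"
    and \<rho> :: real
    and x xstar :: "real ^ 'n::{finite, linorder}"
  assumes "proper_fun f"
    and "lower_semicontinuous f"
    and "scale_invariant f"
    and "signed_permutation_invariant f"
    and "\<And>\<alpha> z. \<alpha> > 0 \<Longrightarrow> prox \<alpha> f z \<noteq> {} \<and> compact (prox \<alpha> f z)"
    and "\<rho> > 0"
    and "x \<in> nonneg_decreasing"
    and F: "\<And>u. F u = ereal (\<rho> / 2 * (norm (u - x))\<^sup>2) + f u"
  shows "xstar \<in> prox (1 / \<rho>) f x \<longleftrightarrow>
    (\<exists>w s :: real ^ 'n::{finite, linorder}.
       is_arg_min (\<lambda>w. ereal (- (\<rho> / 2) * (x \<bullet> w)\<^sup>2) + f w) (\<lambda>w. w \<in> nonneg_sphere) w \<and>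
       (\<forall>i. s $ i = 1 \<or> (s $ i = -1 \<and> x $ i = 0)) \<and>
       (\<chi> i. s $ i * xstar $ i) \<in>
         (if F 0 < F ((x \<bullet> w) *\<^sub>R w) then {0}
          else if F 0 = F ((x \<bullet> w) *\<^sub>R w) then {0, (x \<bullet> w) *\<^sub>R w}
          else {(x \<bullet> w) *\<^sub>R w}))"
proof -
  define c where "c = ereal (\<rho> / 2 * (norm x)\<^sup>2)"
  define G where "G = (\<lambda>w. ereal (- (\<rho> / 2) * (x \<bullet> w)\<^sup>2) + f w)"
  note \<rho> = assms(6)
  have xnn: "0 \<le> x $ i" for i
    using assms(7) by (simp add: nonneg_decreasing_def)
  have f0: "f 0 \<le> f u" for u
    using scale_invariant_lsc_zero_le assms(2,3) by blast
  have f0_fin: "\<bar>f 0\<bar> \<noteq> \<infinity>"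
  proof -
    obtain v where "f v \<noteq> \<infinity>"
      using assms(1) by (auto simp: proper_fun_def)
    then show ?thesis
      using f0[of v] assms(1) by (auto simp: proper_fun_def)
  qed
  have prox_iff: "u \<in> prox (1 / \<rho>) f x \<longleftrightarrow> (\<forall>v. F u \<le> F v)" for u
    by (simp add: prox_def is_arg_min_def F not_less)
  have F_signs: "F (\<chi> i. s $ i * u $ i) = F u"
    if "\<forall>i. s $ i = 1 \<or> (s $ i = -1 \<and> x $ i = 0)" for s u
  proof -
    have "f (\<chi> i. s $ i * u $ i) = f u"
      using that by (intro signed_permutation_invariant_signs[OF assms(4)]) auto
    then show ?thesis
      unfolding F using that dist_signs[of s x u] by simp
  qed
  have F_le: "F ((x \<bullet> w) *\<^sub>R w) \<le> c + G w" if "w \<in> nonneg_sphere" for w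
  proof -
    have "0 \<le> x \<bullet> w"
      using that xnn by (auto simp: inner_vec_def nonneg_sphere_def intro!: sum_nonneg)
    then show ?thesis
      using that prox_objective_at_projection_le[OF assms(3) f0]
      unfolding c_def G_def F by (simp add: nonneg_sphere_def)
  qed
  \<comment> \<open>This supplies a direction when the given minimizer is 0 and determines none
    itself.\<close>
  have ex_w: "\<exists>w. is_arg_min G (\<lambda>w. w \<in> nonneg_sphere) w"
    unfolding G_def
    by (intro compact_ex_arg_min compact_nonneg_sphere nonneg_sphere_nonempty
        open_superlevel_continuous_add_lsc assms(2) continuous_intros)
  have nonzero: "\<exists>w s. is_arg_min G (\<lambda>w. w \<in> nonneg_sphere) w \<and>
      (\<forall>i. s $ i = 1 \<or> (s $ i = -1 \<and> x $ i = 0)) \<and>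
      (\<chi> i. s $ i * u $ i) = (x \<bullet> w) *\<^sub>R w \<and> F u = c + G w"
    if min: "\<And>v. F u \<le> F v" and "u \<noteq> 0" for u
  proof -
    \<comment> \<open>These signs turn \<open>u\<close> into its entrywise absolute value
      \<open>v\<close>. Negative entries of a minimizer occur only at zeros of \<open>x\<close>, so
      \<open>F\<close> does not change.\<close>
    define s :: "real ^ 'n::{finite, linorder}" where "s = (\<chi> i. if u $ i < 0 then -1 else 1)"
    define v where "v = (\<chi> i. s $ i * u $ i)"
    define w where "w = v /\<^sub>R norm v"
    have "F u \<noteq> \<infinity>"
      using min[of 0] f0_fin by (auto simp: F)
    then have "\<bar>f u\<bar> \<noteq> \<infinity>"
      using assms(1) by (auto simp: F proper_fun_def)
    then have s: "\<forall>i. s $ i = 1 \<or> (s $ i = -1 \<and> x $ i = 0)"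
      using minimizer_neg_coordinate[OF assms(4) _ \<rho> F min _ xnn] by (auto simp: s_def)
    have "norm v = norm u"
      unfolding v_def using s by (intro norm_signs) auto
    then have "v \<noteq> 0"
      using \<open>u \<noteq> 0\<close> by auto
    have Fv: "F v = F u"
      unfolding v_def by (rule F_signs[OF s])
    have v: "v = (x \<bullet> w) *\<^sub>R w" "F v = c + G w"
      unfolding w_def c_def G_def
      using nonzero_prox_objective_minimizer[OF assms(3) f0 f0_fin \<rho> \<open>v \<noteq> 0\<close> F] min Fv by metis+
    have w: "w \<in> nonneg_sphere"
      using \<open>v \<noteq> 0\<close> by (auto simp: w_def nonneg_sphere_def v_def s_def)
    have "G w \<le> G w'" if "w' \<in> nonneg_sphere" for w'
    proof -
      \<comment> \<open>The value \<open>c + G w\<close> is the minimum of \<open>F\<close>, while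
        \<open>c + G w'\<close> bounds the value of \<open>F\<close> at a projection from
        above.\<close>
      have "c + G w \<le> c + G w'"
        using F_le[OF that] min Fv v(2) by (metis order_trans)
      then show ?thesis
        by (simp add: c_def ereal_add_le_add_iff)
    qed
    then have "is_arg_min G (\<lambda>w. w \<in> nonneg_sphere) w"
      using w by (auto simp: is_arg_min_def not_less)
    then show ?thesis
      using s v Fv v_def by metis
  qed
  \<comment> \<open>The direction \<open>w'\<close> of a nonzero minimizer may differ from the given
    solution \<open>w\<close>, but both minimize \<open>G\<close>, so the projection onto
    \<open>w\<close> does as well.\<close>
  have proj_min: "F 0 \<le> F v \<or> F ((x \<bullet> w) *\<^sub>R w) \<le> F v"
    if w: "is_arg_min G (\<lambda>w. w \<in> nonneg_sphere) w" for w v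
  proof -
    obtain u where u: "\<And>v. F u \<le> F v"
      using assms(5)[of "1 / \<rho>" x] \<rho> prox_iff by auto
    show ?thesis
    proof (cases "u = 0")
      case False
      then obtain w' where w': "is_arg_min G (\<lambda>w. w \<in> nonneg_sphere) w'" "F u = c + G w'"
        using nonzero u by blast
      then have "G w \<le> G w'"
        using w by (auto simp: is_arg_min_def not_less)
      then have "F ((x \<bullet> w) *\<^sub>R w) \<le> F u"
        using F_le[of w] w w'(2) by (metis add_left_mono is_arg_min_def order_trans)
      then show ?thesis
        using u order_trans by blast
    qed (use u in simp)
  qed
  have zero: "(\<chi> i. 0) = (0 :: real ^ 'n::{finite, linorder})"
    by (simp add: vec_eq_iff)
  show ?thesis
    unfolding G_def[symmetric]
  proof
    assume "xstar \<in> prox (1 / \<rho>) f x"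
    then have min: "\<And>v. F xstar \<le> F v"
      by (simp add: prox_iff)
    show "\<exists>w s. is_arg_min G (\<lambda>w. w \<in> nonneg_sphere) w \<and>
       (\<forall>i. s $ i = 1 \<or> (s $ i = -1 \<and> x $ i = 0)) \<and>
       (\<chi> i. s $ i * xstar $ i) \<in>
         (if F 0 < F ((x \<bullet> w) *\<^sub>R w) then {0}
          else if F 0 = F ((x \<bullet> w) *\<^sub>R w) then {0, (x \<bullet> w) *\<^sub>R w}
          else {(x \<bullet> w) *\<^sub>R w})"
    proof (cases "xstar = 0")
      case True
      obtain w where "is_arg_min G (\<lambda>w. w \<in> nonneg_sphere) w"
        using ex_w by blast
      moreover have "F 0 \<le> F ((x \<bullet> w) *\<^sub>R w)"
        using min True by simp
      ultimately show ?thesis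
        \<comment> \<open>The vector \<open>1\<close> means no flips. Only the first two branches
          can occur, and both contain 0.\<close>
        using True zero by - (rule exI[where x = w], rule exI[where x = 1], simp add: le_less, blast)
    next
      case False
      then obtain w s where w: "is_arg_min G (\<lambda>w. w \<in> nonneg_sphere) w"
        and s: "\<forall>i. s $ i = 1 \<or> (s $ i = -1 \<and> x $ i = 0)"
        and eq: "(\<chi> i. s $ i * xstar $ i) = (x \<bullet> w) *\<^sub>R w"
        using nonzero min by blast
      \<comment> \<open>This excludes the first branch; the other two contain the
        projection.\<close>
      have "\<not> F 0 < F ((x \<bullet> w) *\<^sub>R w)"
        using min[of 0] F_signs[OF s, of xstar] eq by (simp add: not_less)
      then show ?thesis
        using w s eq by - (rule exI[where x = w], rule exI[where x = s], simp)
    qed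
  next
    assume "\<exists>w s. is_arg_min G (\<lambda>w. w \<in> nonneg_sphere) w \<and>
       (\<forall>i. s $ i = 1 \<or> (s $ i = -1 \<and> x $ i = 0)) \<and>
       (\<chi> i. s $ i * xstar $ i) \<in>
         (if F 0 < F ((x \<bullet> w) *\<^sub>R w) then {0}
          else if F 0 = F ((x \<bullet> w) *\<^sub>R w) then {0, (x \<bullet> w) *\<^sub>R w}
          else {(x \<bullet> w) *\<^sub>R w})"
    then obtain w s where w: "is_arg_min G (\<lambda>w. w \<in> nonneg_sphere) w"
      and s: "\<forall>i. s $ i = 1 \<or> (s $ i = -1 \<and> x $ i = 0)"
      and mem: "(\<chi> i. s $ i * xstar $ i) \<in>
         (if F 0 < F ((x \<bullet> w) *\<^sub>R w) then {0}
          else if F 0 = F ((x \<bullet> w) *\<^sub>R w) then {0, (x \<bullet> w) *\<^sub>R w}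
          else {(x \<bullet> w) *\<^sub>R w})"
      by blast
    \<comment> \<open>In every branch the selected point attains the smaller of the two
      values.\<close>
    have "F (\<chi> i. s $ i * xstar $ i) \<le> F 0" "F (\<chi> i. s $ i * xstar $ i) \<le> F ((x \<bullet> w) *\<^sub>R w)"
      using mem by (auto split: if_splits)
    then have "F xstar \<le> F v" for v
      using proj_min[OF w, of v] unfolding F_signs[OF s] by auto
    then show "xstar \<in> prox (1 / \<rho>) f x"
      by (simp add: prox_iff)
  qed
qed

end
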